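(* For every integer $d\ge 2$ there exists a constant $c_d>0$ such that for every positive integer $k$ with $d\ge k\ge 2$ and every prime $q_0$, setting $q=q_0^k$, one has $$\mathrm{IM}(d,q)\ \ge\ c_d\, q^{d-1/k}.$$
   Context: For an integer $d\ge 1$ and a prime power $q$, $\mathrm{IM}(d,q)$ denotes the maximum size of an induced matching in the bipartite point-line incidence graph of $\mathbb{F}_q^d$; equivalently, the largest $m$ for which there exist pairs $(p_1,\ell_1),\dots,(p_m,\ell_m)$ with $p_i\in\mathbb{F}_q^d$ points and $\ell_j\subset\mathbb{F}_q^d$ affine lines such that $p_i\in\ell_j$ if and only if $i=j$. *)

theory Defs
  imports Complex_Main "HOL-Algebra.Weak_Morphisms" "HOL-Computational_Algebra.Primes" "HOL-Library.FuncSet"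
begin

text \<open>Graphs are given by their edge sets, each edge being a set of two vertices.\<close>

definition induced_matching :: "'v set set \<Rightarrow> 'v set set \<Rightarrow> bool" where
  "induced_matching E M \<longleftrightarrow>
     M \<subseteq> E \<and>
     (\<forall>e\<in>M. \<forall>f\<in>M. e \<noteq> f \<longrightarrow> e \<inter> f = {}) \<and>
     (\<forall>e\<in>E. e \<subseteq> \<Union>M \<longrightarrow> e \<in> M)"

text \<open>The affine space \<open>F\<^sup>d\<close>; coordinates are indexed by \<open>0, \<dots>, d - 1\<close>, and functions are
  \<open>undefined\<close> outside this range so that each point has exactly one representation.\<close>

definition affine_points :: "nat \<Rightarrow> ('a, 'm) ring_scheme \<Rightarrow> (nat \<Rightarrow> 'a) set" where
  "affine_points d F = ({..<d} \<rightarrow>\<^sub>E carrier F)"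

definition line_through ::
    "nat \<Rightarrow> ('a, 'm) ring_scheme \<Rightarrow> (nat \<Rightarrow> 'a) \<Rightarrow> (nat \<Rightarrow> 'a) \<Rightarrow> (nat \<Rightarrow> 'a) set" where
  "line_through d F p v = {(\<lambda>i\<in>{..<d}. p i \<oplus>\<^bsub>F\<^esub> t \<otimes>\<^bsub>F\<^esub> v i) | t. t \<in> carrier F}"

definition affine_lines :: "nat \<Rightarrow> ('a, 'm) ring_scheme \<Rightarrow> (nat \<Rightarrow> 'a) set set" where
  "affine_lines d F =
     {line_through d F p v | p v.
        p \<in> affine_points d F \<and> v \<in> affine_points d F \<and> (\<exists>i<d. v i \<noteq> \<zero>\<^bsub>F\<^esub>)}"

definition incidence_edges ::
    "nat \<Rightarrow> ('a, 'm) ring_scheme \<Rightarrow> ((nat \<Rightarrow> 'a) + (nat \<Rightarrow> 'a) set) set set" where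
  "incidence_edges d F =
     {{Inl p, Inr l} | p l. p \<in> affine_points d F \<and> l \<in> affine_lines d F \<and> p \<in> l}"

text \<open>For finite \<open>F\<close>, the maximum is over a finite set, which contains 0.\<close>

definition IM :: "nat \<Rightarrow> ('a, 'm) ring_scheme \<Rightarrow> nat" where
  "IM d F = Max {card M | M. induced_matching (incidence_edges d F) M}"

definition matching_pairs ::
    "nat \<Rightarrow> ('a, 'm) ring_scheme \<Rightarrow> nat \<Rightarrow> (nat \<Rightarrow> nat \<Rightarrow> 'a) \<Rightarrow> (nat \<Rightarrow> (nat \<Rightarrow> 'a) set) \<Rightarrow> bool" where
  "matching_pairs d F m p l \<longleftrightarrow>
     (\<forall>i<m. p i \<in> affine_points d F) \<and> (\<forall>j<m. l j \<in> affine_lines d F) \<and>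
     (\<forall>i<m. \<forall>j<m. p i \<in> l j \<longleftrightarrow> i = j)"

lemma finite_incidence_edges:
  assumes "finite (carrier F)"
  shows "finite (incidence_edges d F)"
proof -
  have P: "finite (affine_points d F)"
    unfolding affine_points_def using assms by (intro finite_PiE) auto
  have "affine_lines d F \<subseteq> (\<lambda>(p, v). line_through d F p v) ` (affine_points d F \<times> affine_points d F)"
    unfolding affine_lines_def by auto
  then have L: "finite (affine_lines d F)"
    by (rule finite_subset) (use P in auto)
  have "incidence_edges d F \<subseteq> (\<lambda>(p, l). {Inl p, Inr l}) ` (affine_points d F \<times> affine_lines d F)"
    unfolding incidence_edges_def by auto
  then show ?thesis
    by (rule finite_subset) (use P L in auto)
qed

lemma induced_matching_of_pairs:
  assumes mp: "matching_pairs d F m p l"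
  shows "\<exists>M. induced_matching (incidence_edges d F) M \<and> card M = m"
proof -
  define e where "e i = {Inl (p i), Inr (l i)}" for i
  define M where "M = e ` {..<m}"
  have pp: "p i \<in> affine_points d F" "l i \<in> affine_lines d F" if "i < m" for i
    using mp that unfolding matching_pairs_def by auto
  have inc: "p i \<in> l j \<longleftrightarrow> i = j" if "i < m" "j < m" for i j
    using mp that unfolding matching_pairs_def by auto
  have pinj: "i = j" if "i < m" "j < m" "p i = p j \<or> l i = l j" for i j
    using inc[of i j] inc[of i i] inc[of j j] that by auto
  have einj: "inj_on e {..<m}"
    by (rule inj_onI) (use pinj in \<open>auto simp: e_def doubleton_eq_iff\<close>)
  have "card M = m"
    unfolding M_def using einj by (simp add: card_image)
  moreover have "induced_matching (incidence_edges d F) M"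
    unfolding induced_matching_def
  proof (intro conjI ballI impI)
    show "M \<subseteq> incidence_edges d F"
    proof
      fix a assume "a \<in> M"
      then obtain i where i: "i < m" "a = e i" unfolding M_def by auto
      then show "a \<in> incidence_edges d F"
        unfolding incidence_edges_def e_def using pp[OF i(1)] inc[OF i(1) i(1)] by auto
    qed
  next
    fix a b assume ab: "a \<in> M" "b \<in> M" "a \<noteq> b"
    then obtain i j where ij: "i < m" "j < m" "a = e i" "b = e j"
      unfolding M_def by auto
    have "i \<noteq> j" using ij ab by auto
    then show "a \<inter> b = {}"
      using ij pinj[of i j] by (auto simp: e_def)
  next
    fix a assume a: "a \<in> incidence_edges d F" "a \<subseteq> \<Union>M"
    then obtain x y where xy: "a = {Inl x, Inr y}" "x \<in> y"
      unfolding incidence_edges_def by auto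
    from a(2) obtain i j where ij: "i < m" "j < m" "x = p i" "y = l j"
      unfolding xy(1) M_def e_def by auto
    then have "i = j" using inc xy(2) by auto
    then show "a \<in> M" unfolding xy(1) M_def e_def using ij by auto
  qed
  ultimately show ?thesis by blast
qed

lemma pairs_of_induced_matching:
  assumes M: "induced_matching (incidence_edges d F) M" and fin: "finite (carrier F)"
  shows "\<exists>p l. matching_pairs d F (card M) p l"
proof -
  have ME: "M \<subseteq> incidence_edges d F"
    using M unfolding induced_matching_def by auto
  then have "finite M"
    using finite_incidence_edges[OF fin] finite_subset by blast
  then obtain e where e: "bij_betw e {0..<card M} M"
    using ex_bij_betw_nat_finite by blast
  have eM: "e i \<in> M" if "i < card M" for i
    using e that unfolding bij_betw_def by auto
  have "\<exists>x y. e i = {Inl x, Inr y} \<and> x \<in> affine_points d F \<and> y \<in> affine_lines d F \<and> x \<in> y"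
    if "i < card M" for i
    using eM[OF that] ME unfolding incidence_edges_def by blast
  then obtain p l where pl: "\<And>i. i < card M \<Longrightarrow> e i = {Inl (p i), Inr (l i)} \<and>
      p i \<in> affine_points d F \<and> l i \<in> affine_lines d F \<and> p i \<in> l i"
    by metis
  have "i = j" if ij: "i < card M" "j < card M" "p i \<in> l j" for i j
  proof -
    let ?f = "{Inl (p i), Inr (l j)}"
    have "?f \<in> incidence_edges d F"
      unfolding incidence_edges_def using pl ij by blast
    moreover have "?f \<subseteq> \<Union>M"
      using eM[OF ij(1)] eM[OF ij(2)] pl[OF ij(1)] pl[OF ij(2)] by blast
    ultimately have fM: "?f \<in> M"
      using M unfolding induced_matching_def by blast
    have disj: "\<And>a b. a \<in> M \<Longrightarrow> b \<in> M \<Longrightarrow> a \<inter> b \<noteq> {} \<Longrightarrow> a = b"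
      using M unfolding induced_matching_def by blast
    have "e i = ?f" "e j = ?f"
      using disj[OF eM[OF ij(1)] fM] disj[OF eM[OF ij(2)] fM] pl[OF ij(1)] pl[OF ij(2)] by auto
    then have "e i = e j" by simp
    then show "i = j"
      using e ij unfolding bij_betw_def inj_on_def by auto
  qed
  then have "matching_pairs d F (card M) p l"
    unfolding matching_pairs_def using pl by blast
  then show ?thesis by blast
qed

text \<open>\<open>IM d F\<close> is also the largest \<open>m\<close> for which there are points \<open>p\<^sub>0, \<dots>, p\<^sub>m\<^sub>-\<^sub>1\<close> and lines
  \<open>l\<^sub>0, \<dots>, l\<^sub>m\<^sub>-\<^sub>1\<close> such that \<open>p\<^sub>i \<in> l\<^sub>j\<close> if and only if \<open>i = j\<close>.\<close>

lemma IM_eq_Max_pairs: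
  assumes "finite (carrier F)"
  shows "IM d F = Max {m. \<exists>p l. matching_pairs d F m p l}"
proof -
  have "{card M | M. induced_matching (incidence_edges d F) M}
      = {m. \<exists>p l. matching_pairs d F m p l}"
    using induced_matching_of_pairs pairs_of_induced_matching[OF _ assms]
    by (auto; metis)
  then show ?thesis unfolding IM_def by simp
qed

lemma finite_induced_matching_cards:
  assumes "finite (carrier F)"
  shows "finite {card M | M. induced_matching (incidence_edges d F) M}"
proof -
  have "{card M | M. induced_matching (incidence_edges d F) M} \<subseteq> card ` Pow (incidence_edges d F)"
    unfolding induced_matching_def by auto
  then show ?thesis
    by (rule finite_subset) (use finite_incidence_edges[OF assms] in auto)
qed

lemma IM_ge_pairs:
  assumes "finite (carrier F)" "matching_pairs d F m p l"
  shows "m \<le> IM d F"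
proof -
  obtain M where "induced_matching (incidence_edges d F) M" "card M = m"
    using induced_matching_of_pairs[OF assms(2)] by blast
  then show ?thesis
    unfolding IM_def by (intro Max_ge finite_induced_matching_cards[OF assms(1)]) auto
qed

lemma IM_attained:
  assumes "finite (carrier F)"
  shows "\<exists>p l. matching_pairs d F (IM d F) p l"
proof -
  have "induced_matching (incidence_edges d F) {}"
    unfolding induced_matching_def incidence_edges_def by auto
  then have "IM d F \<in> {card M | M. induced_matching (incidence_edges d F) M}"
    unfolding IM_def
    by (intro Max_in finite_induced_matching_cards[OF assms]) auto
  then obtain M where "induced_matching (incidence_edges d F) M" "card M = IM d F"
    by auto
  then show ?thesis
    using pairs_of_induced_matching[OF _ assms] by metis
qed

text \<open>\<open>IM\<close> depends only on the isomorphism class of the field, and every finite field is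
  isomorphic to one whose elements are natural numbers. Hence a bound for all fields of type
  \<open>nat ring\<close> with \<open>q\<close> elements is a bound for all fields with \<open>q\<close> elements.\<close>

lemma IM_le_of_ring_iso:
  assumes F: "Ring.ring F" and G: "Ring.ring G" and fin: "finite (carrier F)"
    and h: "h \<in> ring_iso F G"
  shows "IM d F \<le> IM d G"
proof -
  interpret F: Ring.ring F by fact
  interpret G: Ring.ring G by fact
  have hh: "h \<in> ring_hom F G" and bij: "bij_betw h (carrier F) (carrier G)"
    using h unfolding ring_iso_def by auto
  have finG: "finite (carrier G)"
    using bij fin bij_betw_finite by blast
  have hc: "h x \<in> carrier G" if "x \<in> carrier F" for x
    using ring_hom_closed[OF hh that] .
  have h0: "h \<zero>\<^bsub>F\<^esub> = \<zero>\<^bsub>G\<^esub>"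
    using ring_hom_zero[OF hh F G] .
  have hinj: "h x = h y \<longleftrightarrow> x = y" if "x \<in> carrier F" "y \<in> carrier F" for x y
    using bij that unfolding bij_betw_def inj_on_def by auto
  define H where "H p = (\<lambda>i\<in>{..<d}. h (p i))" for p :: "nat \<Rightarrow> 'a"
  have HP: "H p \<in> affine_points d G" if "p \<in> affine_points d F" for p
    using that hc unfolding H_def affine_points_def by auto
  have Hinj: "H p = H p' \<longleftrightarrow> p = p'"
    if P: "p \<in> affine_points d F" "p' \<in> affine_points d F" for p p'
  proof
    assume eq: "H p = H p'"
    show "p = p'"
    proof (rule PiE_ext[of p "{..<d}" "\<lambda>_. carrier F"])
      fix i assume i: "i \<in> {..<d}"
      have "h (p i) = h (p' i)"
        using fun_cong[OF eq, of i] i unfolding H_def by simp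
      then show "p i = p' i"
        using hinj[of "p i" "p' i"] P i unfolding affine_points_def by (auto simp: PiE_iff)
    qed (use P in \<open>auto simp: affine_points_def\<close>)
  qed simp
  have shift: "(\<lambda>i\<in>{..<d}. p i \<oplus>\<^bsub>F\<^esub> t \<otimes>\<^bsub>F\<^esub> v i) \<in> affine_points d F"
    if "p \<in> affine_points d F" "v \<in> affine_points d F" "t \<in> carrier F" for p v t
    using that unfolding affine_points_def by (auto simp: PiE_iff)
  have Hshift: "H (\<lambda>i\<in>{..<d}. p i \<oplus>\<^bsub>F\<^esub> t \<otimes>\<^bsub>F\<^esub> v i)
      = (\<lambda>i\<in>{..<d}. H p i \<oplus>\<^bsub>G\<^esub> h t \<otimes>\<^bsub>G\<^esub> H v i)"
    if "p \<in> affine_points d F" "v \<in> affine_points d F" "t \<in> carrier F" for p v t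
    using that unfolding H_def affine_points_def
    by (intro ext) (auto simp: PiE_iff ring_hom_add[OF hh] ring_hom_mult[OF hh])
  have surj: "h ` carrier F = carrier G"
    using bij unfolding bij_betw_def by auto
  have HL: "H ` line_through d F p v = line_through d G (H p) (H v)"
    if "p \<in> affine_points d F" "v \<in> affine_points d F" for p v
  proof -
    have "H ` line_through d F p v
        = (\<lambda>t. H (\<lambda>i\<in>{..<d}. p i \<oplus>\<^bsub>F\<^esub> t \<otimes>\<^bsub>F\<^esub> v i)) ` carrier F"
      unfolding line_through_def by auto
    also have "\<dots> = (\<lambda>t. \<lambda>i\<in>{..<d}. H p i \<oplus>\<^bsub>G\<^esub> h t \<otimes>\<^bsub>G\<^esub> H v i) ` carrier F"
      by (intro image_cong refl Hshift that)
    also have "\<dots> = (\<lambda>s. \<lambda>i\<in>{..<d}. H p i \<oplus>\<^bsub>G\<^esub> s \<otimes>\<^bsub>G\<^esub> H v i) ` (h ` carrier F)"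
      by (simp add: image_image)
    also have "\<dots> = line_through d G (H p) (H v)"
      unfolding surj line_through_def by auto
    finally show ?thesis .
  qed
  have LP: "l \<subseteq> affine_points d F" if "l \<in> affine_lines d F" for l
    using that shift unfolding affine_lines_def line_through_def by blast
  have LL: "H ` l \<in> affine_lines d G" if l: "l \<in> affine_lines d F" for l
  proof -
    obtain p v i where pv: "l = line_through d F p v" "p \<in> affine_points d F"
      "v \<in> affine_points d F" "i < d" "v i \<noteq> \<zero>\<^bsub>F\<^esub>"
      using l unfolding affine_lines_def by auto
    have vi: "v i \<in> carrier F"
      using pv unfolding affine_points_def by (auto simp: PiE_iff)
    have "H v i \<noteq> \<zero>\<^bsub>G\<^esub>"
      using hinj[OF vi, of "\<zero>\<^bsub>F\<^esub>"] pv h0 unfolding H_def by auto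
    then have "\<exists>i<d. H v i \<noteq> \<zero>\<^bsub>G\<^esub>"
      using pv(4) by blast
    then show ?thesis
      unfolding pv(1) HL[OF pv(2,3)] affine_lines_def using HP pv(2,3) by blast
  qed
  obtain p l where pl: "matching_pairs d F (IM d F) p l"
    using IM_attained[OF fin] by blast
  have "H (p i) \<in> H ` l j \<longleftrightarrow> p i \<in> l j" if "i < IM d F" "j < IM d F" for i j
  proof -
    have "p i \<in> affine_points d F" "l j \<subseteq> affine_points d F"
      using pl that LP unfolding matching_pairs_def by auto
    then show ?thesis using Hinj by blast
  qed
  then have "matching_pairs d G (IM d F) (\<lambda>i. H (p i)) (\<lambda>j. H ` l j)"
    using pl HP LL unfolding matching_pairs_def by auto
  then show ?thesis
    by (rule IM_ge_pairs[OF finG])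
qed

lemma exists_nat_model:
  assumes F: "field F" and fin: "finite (carrier F)"
  shows "\<exists>G :: nat ring. field G \<and> card (carrier G) = card (carrier F) \<and> IM d G = IM d F"
proof -
  interpret F: field F by fact
  obtain h where h: "bij_betw h (carrier F) {0..<card (carrier F)}"
    using ex_bij_betw_finite_nat[OF fin] by blast
  then have inj: "inj_on h (carrier F)"
    by (auto simp: bij_betw_def)
  define G where "G = image_ring h F"
  have iso: "h \<in> ring_iso F G"
    unfolding G_def by (rule inj_imp_image_ring_iso[OF inj])
  have "field (G\<lparr>zero := h \<zero>\<^bsub>F\<^esub>\<rparr>)"
    by (rule F.ring_iso_imp_img_field[OF iso])
  moreover have "h \<zero>\<^bsub>F\<^esub> = \<zero>\<^bsub>G\<^esub>"
    unfolding G_def image_ring_zero ..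
  ultimately have G: "field G" by simp
  interpret G: field G by fact
  have cG: "bij_betw h (carrier F) (carrier G)"
    using iso unfolding ring_iso_def by auto
  have card: "card (carrier G) = card (carrier F)" and finG: "finite (carrier G)"
    using bij_betw_same_card[OF cG] bij_betw_finite[OF cG] fin by auto
  have iso': "inv_into (carrier F) h \<in> ring_iso G F"
    by (rule ring_iso_set_sym[OF F.ring_axioms iso])
  have "IM d G = IM d F"
    using IM_le_of_ring_iso[OF F.ring_axioms G.ring_axioms fin iso]
      IM_le_of_ring_iso[OF G.ring_axioms F.ring_axioms finG iso']
    by (rule antisym[rotated])
  then show ?thesis
    using G card by blast
qed

end

theory Submission
  imports "Jordan_Normal_Form.Determinant" "HOL-Algebra.Multiplicative_Group" Defs
begin

text \<open>Let \<open>M x = det (x\<^sub>i\<^bsup>q0^j\<^esup>)\<close> be the Moore determinant of the first \<open>k\<close> coordinates of \<open>x\<close>.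
  Since Frobenius shifts the columns of the Moore matrix cyclically, along the line through \<open>x\<close> in
  the direction of its coordinatewise Frobenius image (continued by zeros) all mixed terms of the
  multilinear expansion have a repeated column, and \<open>M\<close> takes the value
  \<open>M x (1 + (- 1)\<^bsup>k - 1\<^esup> N t)\<close>, where \<open>N\<close> is the anisotropic norm form. So this line meets the
  level set of \<open>M\<close> through \<open>x\<close> only in \<open>x\<close>, provided that \<open>M x \<noteq> 0\<close>, and each nonzero level set
  yields an induced matching. At least \<open>q\<^sup>d / 2\<^sup>d\<close> points have \<open>M x \<noteq> 0\<close>, while \<open>M\<^bsup>q0\<^esup> = \<plusminus> M\<close>
  leaves at most \<open>q0\<close> values, so some level set has at least \<open>q\<^sup>d / (2\<^sup>d q0)\<close> points.\<close>

section \<open>Determinants of cyclically shifted matrices\<close>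

text \<open>Only the identity and the full cycle \<open>j \<mapsto> Suc j mod k\<close> contribute;
  the sign of that cycle is \<open>(- 1) ^ (k - 1)\<close>.\<close>

lemma det_cyclic_bidiagonal:
  fixes a :: "'a::comm_ring_1" and T :: "nat \<Rightarrow> 'a"
  assumes k: "2 \<le> k"
  shows "det (mat k k (\<lambda>(i, j). (if i = j then a else 0) + (if i = Suc j mod k then T j else 0)))
     = a ^ k + (- 1) ^ (k - 1) * prod T {..<k}"
proof -
  obtain n where n: "k = Suc (Suc n)"
    using k by (metis add_2_eq_Suc le_Suc_ex)
  define B where "B = mat k k (\<lambda>(i, j). (if i = j then a else 0) + (if i = Suc j mod k then T j else 0))"
  have B: "B \<in> carrier_mat k k" unfolding B_def by simp
  then have dims: "dim_row B = k" "dim_col B = k" by auto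
  let ?l = "Suc n"
  have entry: "B $$ (i, j) = (if i = j then a else 0)
      + (if i = (if j = ?l then 0 else Suc j) then T j else 0)" if "i < k" "j < k" for i j
  proof -
    have "Suc j mod k = (if j = ?l then 0 else Suc j)" using that n by auto
    then show ?thesis using that by (simp add: B_def)
  qed
  have "det B = (\<Sum>j<k. B $$ (0, j) * cofactor B 0 j)"
    by (rule laplace_expansion_row[OF B]) (use n in simp)
  \<comment> \<open>Row 0 contains \<open>a\<close> in column 0 and the wrap-around entry
    \<open>T ?l\<close> in the last column. Both minors are triangular, with diagonals of
    \<open>a\<close>'s and of \<open>T\<close>'s.\<close>
  also have "\<dots> = (\<Sum>j\<in>{0, ?l}. B $$ (0, j) * cofactor B 0 j)"
    by (rule sum.mono_neutral_right) (auto simp: entry n)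
  also have "\<dots> = a * cofactor B 0 0 + T ?l * cofactor B 0 ?l"
    by (simp add: entry n)
  finally have *: "det B = a * cofactor B 0 0 + T ?l * cofactor B 0 ?l" .
  have "det (mat_delete B 0 0) = prod_list (diag_mat (mat_delete B 0 0))"
    by (rule det_lower_triangular[of ?l]) (auto simp: mat_delete_def entry dims n)
  also have "\<dots> = (\<Prod>i\<in>{0..<?l}. a)"
    unfolding prod_list_diag_prod
    by (intro prod.cong) (auto simp: mat_delete_def entry dims n)
  finally have d0: "det (mat_delete B 0 0) = a ^ ?l" by simp
  have "det (mat_delete B 0 ?l) = prod_list (diag_mat (mat_delete B 0 ?l))"
    by (rule det_upper_triangular[of _ ?l]) (auto simp: mat_delete_def entry dims n intro!: upper_triangularI)
  also have "\<dots> = prod T {0..<?l}"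
    unfolding prod_list_diag_prod
    by (intro prod.cong) (auto simp: mat_delete_def entry dims n)
  finally have dl: "det (mat_delete B 0 ?l) = prod T {..<?l}" by (simp add: atLeast0LessThan)
  have "det B = a ^ k + (- 1) ^ (k - 1) * prod T {..<k}"
    unfolding * cofactor_def d0 dl by (simp add: n algebra_simps)
  then show ?thesis unfolding B_def .
qed

text \<open>The column operation is right multiplication by the bidiagonal matrix above, so
  multiplicativity of \<open>det\<close> replaces the multilinear expansion. Both
  \<open>a = 1\<close> (moving along a line) and \<open>a = 0\<close> (a pure shift) are used
  later.\<close>

lemma det_add_cyclic_shift:
  fixes a :: "'a::comm_ring_1" and T :: "nat \<Rightarrow> 'a"
  assumes k: "2 \<le> k"
  shows "det (mat k k (\<lambda>(i, j). a * X i j + T j * X i (Suc j mod k)))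
     = det (mat k k (\<lambda>(i, j). X i j)) * (a ^ k + (- 1) ^ (k - 1) * prod T {..<k})"
proof -
  let ?B = "mat k k (\<lambda>(i, j). (if i = j then a else 0) + (if i = Suc j mod k then T j else 0))"
  let ?X = "mat k k (\<lambda>(i, j). X i j)"
  have "mat k k (\<lambda>(i, j). a * X i j + T j * X i (Suc j mod k)) = ?X * ?B"
  proof (rule eq_matI)
    fix i j assume "i < dim_row (?X * ?B)" "j < dim_col (?X * ?B)"
    then have ij: "i < k" "j < k" by auto
    have m: "Suc j mod k < k" using k by simp
    have "(?X * ?B) $$ (i, j)
        = (\<Sum>l\<in>{0..<k}. X i l * ((if l = j then a else 0) + (if l = Suc j mod k then T j else 0)))"
      using ij by (simp add: scalar_prod_def)
    also have "\<dots> = (\<Sum>l\<in>{0..<k}. (if l = j then X i l * a else 0))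
        + (\<Sum>l\<in>{0..<k}. if l = Suc j mod k then X i l * T j else 0)"
      unfolding sum.distrib[symmetric] by (intro sum.cong) (auto simp: algebra_simps)
    also have "\<dots> = X i j * a + X i (Suc j mod k) * T j"
      using ij m by simp
    finally show "mat k k (\<lambda>(i, j). a * X i j + T j * X i (Suc j mod k)) $$ (i, j) = (?X * ?B) $$ (i, j)"
      using ij by (simp add: mult.commute)
  qed auto
  then show ?thesis
    by (simp add: det_mult[of _ k] det_cyclic_bidiagonal[OF k])
qed

section \<open>Finite fields as quotients of a commutative ring\<close>

text \<open>The determinant library needs a type class, whereas \<open>F\<close> is a record. Determinants over \<open>F\<close> are
  therefore computed over a ring type \<open>'r\<close> that maps onto \<open>F\<close>; \<open>exists_ring_cover\<close> provides the
  integer polynomials, evaluated at a generator of the multiplicative group.\<close>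

locale ring_cover = Ring.field F for F :: "('a, 'm) ring_scheme" (structure) +
  fixes h :: "'r::comm_ring_1 \<Rightarrow> 'a"
  assumes h_add: "h (x + y) = h x \<oplus> h y"
    and h_mult: "h (x * y) = h x \<otimes> h y"
    and h_one: "h 1 = \<one>"
    and h_range: "range h = carrier F"
begin

lemma h_closed [simp, intro]: "h x \<in> carrier F"
  using h_range by auto

lemma h_zero: "h 0 = \<zero>"
  using h_add[of 0 0] add.l_cancel_one'[of "h 0" "h 0"] by simp

lemma h_uminus: "h (- x) = \<ominus> h x"
  using h_add[of x "- x"] h_zero by (metis add.right_inverse add.inv_comm add.inv_equality h_closed minus_equality add.m_comm)

lemma h_cong_iff: "h x = h y \<longleftrightarrow> h (x - y) = \<zero>"
proof -
  have "h (x - y) = h x \<ominus> h y" using h_add[of x "- y"] h_uminus by (simp add: a_minus_def)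
  then show ?thesis by (simp add: r_right_minus_eq)
qed

lemma h_mult_zero_iff: "h (x * y) = \<zero> \<longleftrightarrow> h x = \<zero> \<or> h y = \<zero>"
  by (simp add: h_mult integral_iff)

lemma h_power: "h (x ^ n) = h x [^] n"
  by (induction n) (auto simp: h_one h_mult m_comm)

lemma h_power_zeroD: "h (x ^ n) = \<zero> \<Longrightarrow> h x = \<zero>"
  by (induction n) (auto simp: h_one h_mult_zero_iff)

lemma h_power_cong: "h x = h y \<Longrightarrow> h (x ^ n) = h (y ^ n)"
  by (simp add: h_power)

lemma h_sum_cong: "(\<And>i. i \<in> A \<Longrightarrow> h (f i) = h (g i)) \<Longrightarrow> h (sum f A) = h (sum g A)"
  by (induction A rule: infinite_finite_induct) (auto simp: h_add)

lemma h_prod_cong: "(\<And>i. i \<in> A \<Longrightarrow> h (f i) = h (g i)) \<Longrightarrow> h (prod f A) = h (prod g A)"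
  by (induction A rule: infinite_finite_induct) (auto simp: h_mult)

lemma h_prod_nonzero: "(\<And>i. i \<in> A \<Longrightarrow> h (f i) \<noteq> \<zero>) \<Longrightarrow> h (prod f A) \<noteq> \<zero>"
  by (induction A rule: infinite_finite_induct) (auto simp: h_mult_zero_iff h_one)

text \<open>The determinant is a polynomial in the entries, so its image in \<open>F\<close> does
  not depend on the chosen preimages.\<close>

lemma h_det_cong:
  assumes "\<And>i j. i < n \<Longrightarrow> j < n \<Longrightarrow> h (X i j) = h (Y i j)"
  shows "h (det (mat n n (\<lambda>(i, j). X i j))) = h (det (mat n n (\<lambda>(i, j). Y i j)))"
proof -
  have "p i < n" if "p permutes {0..<n}" "i < n" for p i
    using permutes_in_image[OF that(1), of i] that(2) by simp
  then show ?thesis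
    unfolding det_def
    by (auto simp: h_mult intro!: h_sum_cong arg_cong2[of _ _ _ _ "(\<otimes>)"] h_prod_cong assms)
qed

text \<open>An arbitrary preimage, not a homomorphism: identities between lifts are only claimed
  after applying \<open>h\<close>.\<close>

definition lift :: "'a \<Rightarrow> 'r" where
  "lift x = inv_into UNIV h x"

lemma h_lift [simp]: "x \<in> carrier F \<Longrightarrow> h (lift x) = x"
  unfolding lift_def using h_range by (simp add: f_inv_into_f)

text \<open>The usual root bound, by splitting off linear factors. Zeros are counted in
  \<open>F\<close>, so the leading coefficient has to survive \<open>h\<close>.\<close>

lemma card_roots_le:
  assumes "degree f \<le> N" and "h (Polynomial.coeff f N) \<noteq> \<zero>"
  shows "finite {x \<in> carrier F. h (poly f (lift x)) = \<zero>} \<and>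
    card {x \<in> carrier F. h (poly f (lift x)) = \<zero>} \<le> N"
  using assms
proof (induction N arbitrary: f)
  case 0
  then obtain c where "f = [:c:]" by (metis degree_0_id le_zero_eq)
  then show ?case using 0 by simp
next
  case (Suc N)
  show ?case
  proof (cases "{x \<in> carrier F. h (poly f (lift x)) = \<zero>} = {}")
    case False
    then obtain a where a: "a \<in> carrier F" "h (poly f (lift a)) = \<zero>" by auto
    define g where "g = synthetic_div f (lift a)"
    \<comment> \<open>The remainder need not vanish in \<open>'r\<close>; only its image under
      \<open>h\<close> is zero.\<close>
    have f: "f = [:- lift a, 1:] * g + [:poly f (lift a):]"
      unfolding g_def by (rule synthetic_div_correct'[symmetric])
    have dg: "degree g \<le> N"
      using Suc.prems(1) unfolding g_def degree_synthetic_div by simp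
    have "Polynomial.coeff f (Suc N) = Polynomial.coeff g N"
      using arg_cong[OF f, of "\<lambda>p. Polynomial.coeff p (Suc N)"] dg
      by (simp add: coeff_eq_0 le_imp_less_Suc)
    then have IH: "finite {x \<in> carrier F. h (poly g (lift x)) = \<zero>}"
        "card {x \<in> carrier F. h (poly g (lift x)) = \<zero>} \<le> N"
      using Suc.IH[OF dg] Suc.prems(2) by auto
    have sub: "{x \<in> carrier F. h (poly f (lift x)) = \<zero>}
        \<subseteq> insert a {x \<in> carrier F. h (poly g (lift x)) = \<zero>}"
    proof
      fix x assume "x \<in> {x \<in> carrier F. h (poly f (lift x)) = \<zero>}"
      then have x: "x \<in> carrier F" "h (poly f (lift x)) = \<zero>" by auto
      have "poly f (lift x) = (lift x - lift a) * poly g (lift x) + poly f (lift a)"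
        using arg_cong[OF f, of "\<lambda>p. poly p (lift x)"] by (simp add: algebra_simps)
      then have "h ((lift x - lift a) * poly g (lift x)) = \<zero>"
        using x a h_add by simp
      then have "h (lift x) = h (lift a) \<or> h (poly g (lift x)) = \<zero>"
        unfolding h_mult_zero_iff h_cong_iff[symmetric] .
      then show "x \<in> insert a {x \<in> carrier F. h (poly g (lift x)) = \<zero>}"
        using x a by auto
    qed
    have "card (insert a {x \<in> carrier F. h (poly g (lift x)) = \<zero>}) \<le> Suc N"
      using IH by (simp add: card_insert_if)
    then show ?thesis
      using sub IH(1) finite_subset card_mono[OF _ sub] by (meson finite_insert le_trans)
  qed (metis card.empty finite.emptyI le0)
qed

end

lemma exists_ring_cover:
  fixes F :: "('a, 'm) ring_scheme"
  assumes F: "Ring.field F" and fin: "finite (carrier F)"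
  shows "\<exists>h :: int poly \<Rightarrow> 'a. ring_cover F h"
proof -
  interpret F: Ring.field F by fact
  obtain g where g0: "g \<in> carrier (mult_of F)"
    and gen: "carrier (mult_of F) = {g [^]\<^bsub>F\<^esub> i | i::nat. i \<in> UNIV}"
    using F.finite_field_mult_group_has_gen[OF fin] by blast
  then have g: "g \<in> carrier F" by simp
  define e where "e z = [z] \<cdot>\<^bsub>F\<^esub> \<one>\<^bsub>F\<^esub>" for z :: int
  have e_closed: "e z \<in> carrier F" for z unfolding e_def by simp
  have e_add: "e (x + y) = e x \<oplus>\<^bsub>F\<^esub> e y" for x y
    unfolding e_def by (simp add: F.add.int_pow_mult)
  have e_mult: "e (x * y) = e x \<otimes>\<^bsub>F\<^esub> e y" for x y
    unfolding e_def by (simp add: F.add_pow_ldistr_int F.add.int_pow_pow mult.commute)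
  have e0: "e 0 = \<zero>\<^bsub>F\<^esub>"
    using e_add[of 0 0] F.add.l_cancel_one'[of "e 0" "e 0"] e_closed by simp
  have e1: "e 1 = \<one>\<^bsub>F\<^esub>" unfolding e_def by simp
  \<comment> \<open>Horner evaluation at \<open>g\<close>, with integer coefficients sent to
    \<open>F\<close> by \<open>e\<close>.\<close>
  define h where "h p = fold_coeffs (\<lambda>a v. e a \<oplus>\<^bsub>F\<^esub> g \<otimes>\<^bsub>F\<^esub> v) p \<zero>\<^bsub>F\<^esub>" for p
  have h0: "h 0 = \<zero>\<^bsub>F\<^esub>" unfolding h_def by simp
  have hC: "h (pCons a p) = e a \<oplus>\<^bsub>F\<^esub> g \<otimes>\<^bsub>F\<^esub> h p" for a p
    unfolding h_def using e0 g by (cases "p = 0"; cases "a = 0") auto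
  have cl: "h p \<in> carrier F" for p
    by (induction p) (use h0 hC g e_closed in auto)
  have add: "h (p + q) = h p \<oplus>\<^bsub>F\<^esub> h q" for p q
  proof (induction p q rule: poly_induct2)
    case (pCons a p b q)
    then show ?case
      using g cl e_closed by (simp add: hC e_add F.r_distr F.a_ac)
  qed (simp add: h0)
  have smult: "h (smult a p) = e a \<otimes>\<^bsub>F\<^esub> h p" for a p
  proof (induction p)
    case (pCons b p)
    then show ?case
      using g cl e_closed by (simp add: hC e_mult F.r_distr F.m_ac)
  qed (simp add: h0 e_closed)
  have mult: "h (p * q) = h p \<otimes>\<^bsub>F\<^esub> h q" for p q
  proof (induction p)
    case (pCons a p)
    then show ?case
      using g cl e_closed by (simp add: hC e0 add smult F.l_distr F.m_assoc)
  qed (simp add: h0 cl)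
  have one: "h 1 = \<one>\<^bsub>F\<^esub>"
    unfolding one_pCons using hC h0 e1 g by simp
  have hX: "h ([:0, 1:] ^ i) = g [^]\<^bsub>F\<^esub> i" for i :: nat
    by (induction i) (use g in \<open>auto simp: one mult hC h0 e0 e1 F.m_comm cl simp del: mult_pCons_left\<close>)
  have "carrier F \<subseteq> range h"
  proof
    fix x assume x: "x \<in> carrier F"
    show "x \<in> range h"
    proof (cases "x = \<zero>\<^bsub>F\<^esub>")
      case True
      then show ?thesis using h0 by (metis rangeI)
    next
      case False
      then obtain i :: nat where "x = g [^]\<^bsub>F\<^esub> i"
        using x gen by auto
      then show ?thesis using hX[of i] by (metis rangeI)
    qed
  qed
  then have "range h = carrier F" using cl by auto
  then have "ring_cover F h"
    by unfold_locales (use add mult one in auto)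
  then show ?thesis by blast
qed


section \<open>The Moore determinant\<close>

locale prime_power_field = ring_cover F h
  for F :: "('a, 'm) ring_scheme" (structure) and h :: "'r::comm_ring_1 \<Rightarrow> 'a" +
  fixes q0 k :: nat
  assumes prime: "Factorial_Ring.prime q0"
    and k: "2 \<le> k"
    and card_F: "card (carrier F) = q0 ^ k"
begin

section \<open>Characteristic and Frobenius\<close>

lemma q0_ge: "2 \<le> q0"
  using prime by (rule prime_ge_2_nat)

lemma finite_F: "finite (carrier F)"
  using card_F q0_ge by (intro card_ge_0_finite) simp

lemma finite_affine_points: "finite (affine_points n F)"
  unfolding affine_points_def using finite_F by (intro finite_PiE) auto

text \<open>The order of the additive group annihilates \<open>\<one>\<close>, so the image of
  \<open>q0 ^ k\<close> vanishes; without zero divisors the image of \<open>q0\<close> does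
  too.\<close>

lemma h_char: "h (of_nat q0) = \<zero>"
proof -
  have add_pow: "h (of_nat n) = [n] \<cdot> \<one>" for n :: nat
    by (induction n) (auto simp: h_zero h_one h_add a_comm)
  have "h (of_nat (q0 ^ k)) = \<zero>"
    using group.pow_order_eq_1[OF a_group, of \<one>] card_F
    unfolding add_pow by (simp add: add_pow_def order_def)
  then show ?thesis
    using h_power_zeroD[of "of_nat q0" k] by simp
qed

lemma h_freshman: "h ((a + b) ^ q0) = h (a ^ q0 + b ^ q0)"
proof -
  have "h ((a + b) ^ q0) = h (\<Sum>i\<le>q0. of_nat (q0 choose i) * a ^ i * b ^ (q0 - i))"
    by (simp add: binomial_ring)
  also have "\<dots> = h (\<Sum>i\<le>q0. (if i = 0 then b ^ q0 else 0) + (if i = q0 then a ^ q0 else 0))"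
  proof (rule h_sum_cong)
    fix i assume i: "i \<in> {..q0}"
    show "h (of_nat (q0 choose i) * a ^ i * b ^ (q0 - i))
        = h ((if i = 0 then b ^ q0 else 0) + (if i = q0 then a ^ q0 else 0))"
    proof (cases "i = 0 \<or> i = q0")
      case True
      then show ?thesis using q0_ge by auto
    next
      case False
      then have "q0 dvd q0 choose i"
        using i prime by (intro dvd_choose_prime) auto
      then obtain m where "q0 choose i = q0 * m" by blast
      then show ?thesis
        using False by (simp add: h_mult h_char h_zero)
    qed
  qed
  also have "\<dots> = h (a ^ q0 + b ^ q0)"
    by (simp add: sum.distrib add.commute)
  finally show ?thesis .
qed

lemma h_freshman_power: "h ((a + b) ^ (q0 ^ j)) = h (a ^ (q0 ^ j) + b ^ (q0 ^ j))"
proof (induction j)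
  case (Suc j)
  have "h ((a + b) ^ (q0 ^ Suc j)) = h (((a + b) ^ (q0 ^ j)) ^ q0)"
    by (simp add: power_mult[symmetric] mult.commute)
  also have "\<dots> = h ((a ^ (q0 ^ j) + b ^ (q0 ^ j)) ^ q0)"
    by (rule h_power_cong[OF Suc.IH])
  also have "\<dots> = h (a ^ (q0 ^ Suc j) + b ^ (q0 ^ Suc j))"
    by (simp add: h_freshman power_mult[symmetric] mult.commute)
  finally show ?case .
qed simp

lemma h_freshman_sum: "h (sum f A ^ q0) = h (\<Sum>i\<in>A. f i ^ q0)"
proof (induction A rule: infinite_finite_induct)
  case (insert x A)
  then show ?case by (simp add: h_freshman h_add)
qed (use q0_ge in \<open>auto simp: power_0_left\<close>)

text \<open>Additivity of Frobenius applied to \<open>1 + (- 1) = 0\<close> treats even and odd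
  \<open>q0\<close> alike.\<close>

lemma h_minus_one_power: "h ((- 1) ^ q0) = h (- 1)"
proof -
  have "h ((1 + (- 1)) ^ q0) = h 1 \<oplus> h ((- 1) ^ q0)"
    by (simp only: h_freshman h_add power_one)
  then have "h 1 \<oplus> h ((- 1) ^ q0) = h 1 \<oplus> h (- 1)"
    using q0_ge h_add[of 1 "- 1"] by (simp add: h_zero power_0_left)
  then show ?thesis by simp
qed

lemma h_power_card: "h (a ^ (q0 ^ k)) = h a"
proof (cases "h a = \<zero>")
  case True
  then show ?thesis using q0_ge by (simp add: h_power nat_pow_zero)
next
  case False
  then have "h a [^] card (Units F) = \<one>"
    by (intro units_power_order_eq_one) (use finite_F in \<open>simp_all add: field_Units\<close>)
  moreover have "card (Units F) = q0 ^ k - 1"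
    using finite_F card_F by (simp add: field_Units)
  moreover have "q0 ^ k = Suc (q0 ^ k - 1)" using q0_ge by simp
  ultimately show ?thesis
    by (metis h_power h_closed l_one nat_pow_Suc)
qed

text \<open>Frobenius respects sums and products and fixes the signs, hence passes through the
  Leibniz formula.\<close>

lemma h_frobenius_det:
  "h (det (mat n n (\<lambda>(i, j). X i j)) ^ q0) = h (det (mat n n (\<lambda>(i, j). X i j ^ q0)))"
proof -
  let ?P = "{p. p permutes {0..<n}}"
  have sgn: "h (signof p ^ q0) = h (signof p)" for p :: "nat \<Rightarrow> nat"
    by (simp add: sign_def h_minus_one_power)
  have bound: "p i < n" if "p permutes {0..<n}" "i < n" for p i
    using permutes_in_image[OF that(1), of i] that(2) by simp
  have "h (det (mat n n (\<lambda>(i, j). X i j)) ^ q0) = h ((\<Sum>p\<in>?P. signof p * (\<Prod>i=0..<n. X i (p i))) ^ q0)"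
    unfolding det_def using bound
    by (auto intro!: arg_cong[of _ _ "\<lambda>x. h (x ^ q0)"] sum.cong prod.cong arg_cong2[of _ _ _ _ "(*)"])
  also have "\<dots> = h (\<Sum>p\<in>?P. (signof p * (\<Prod>i=0..<n. X i (p i))) ^ q0)"
    by (rule h_freshman_sum)
  also have "\<dots> = h (\<Sum>p\<in>?P. signof p * (\<Prod>i=0..<n. X i (p i) ^ q0))"
    by (intro h_sum_cong) (simp add: power_mult_distrib h_mult sgn prod_power_distrib)
  also have "\<dots> = h (det (mat n n (\<lambda>(i, j). X i j ^ q0)))"
    unfolding det_def using bound
    by (auto intro!: arg_cong[of _ _ h] sum.cong prod.cong arg_cong2[of _ _ _ _ "(*)"])
  finally show ?thesis .
qed

section \<open>Moore determinants along lines\<close>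

text \<open>The size \<open>n\<close> is variable because the later count adds one coordinate at a
  time, starting from the empty determinant.\<close>

definition moore :: "nat \<Rightarrow> (nat \<Rightarrow> 'a) \<Rightarrow> 'a" where
  "moore n x = h (det (mat n n (\<lambda>(i, j). lift (x i) ^ (q0 ^ j))))"

lemma moore_closed: "moore n x \<in> carrier F"
  unfolding moore_def by simp

lemma moore_cong:
  assumes "\<And>i. i < n \<Longrightarrow> x i = y i"
  shows "moore n x = moore n y"
  unfolding moore_def by (rule h_det_cong) (simp add: assms)

lemma h_power_cyclic:
  assumes "j < k"
  shows "h (a ^ (q0 ^ Suc j)) = h (a ^ (q0 ^ (Suc j mod k)))"
proof (cases "Suc j = k")
  case True
  then show ?thesis using h_power_card[of a] by simp
qed (use assms in simp)

text \<open>By additivity of Frobenius, column \<open>j\<close> for \<open>z\<close> is column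
  \<open>j\<close> for \<open>x\<close> plus \<open>t ^ (q0 ^ j)\<close> times the cyclically next
  column. The product of these powers is the norm of \<open>t\<close> to the subfield of order
  \<open>q0\<close>.\<close>

lemma moore_shift:
  assumes x: "\<And>i. i < k \<Longrightarrow> x i \<in> carrier F" and t: "t \<in> carrier F"
    and z: "\<And>i. i < k \<Longrightarrow> z i = x i \<oplus> t \<otimes> (x i [^] q0)"
  shows "moore k z = moore k x \<otimes> (\<one> \<oplus> h ((- 1) ^ (k - 1) * (\<Prod>j<k. lift t ^ (q0 ^ j))))"
proof -
  let ?T = "\<lambda>j. lift t ^ (q0 ^ j)" and ?X = "\<lambda>i j. lift (x i) ^ (q0 ^ j)"
  have "moore k z = h (det (mat k k (\<lambda>(i, j). 1 * ?X i j + ?T j * ?X i (Suc j mod k))))"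
    unfolding moore_def
  proof (rule h_det_cong)
    fix i j assume ij: "i < k" "j < k"
    have "h (lift (z i)) = h (lift (x i) + lift t * lift (x i) ^ q0)"
      using x[OF ij(1)] t by (simp add: z[OF ij(1)] h_add h_mult h_power)
    then have "h (lift (z i) ^ (q0 ^ j)) = h ((lift (x i) + lift t * lift (x i) ^ q0) ^ (q0 ^ j))"
      by (rule h_power_cong)
    also have "\<dots> = h (?X i j + ?T j * lift (x i) ^ (q0 ^ Suc j))"
      by (simp add: h_freshman_power power_mult_distrib power_mult[symmetric])
    also have "\<dots> = h (1 * ?X i j + ?T j * ?X i (Suc j mod k))"
      using h_power_cyclic[OF ij(2), of "lift (x i)"] by (simp add: h_add h_mult)
    finally show "h (lift (z i) ^ (q0 ^ j)) = h (1 * ?X i j + ?T j * ?X i (Suc j mod k))" .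
  qed
  also have "\<dots> = moore k x \<otimes> h (1 + (- 1) ^ (k - 1) * prod ?T {..<k})"
    unfolding det_add_cyclic_shift[OF k, of 1 ?X ?T] moore_def h_mult power_one ..
  finally show ?thesis by (simp add: h_add h_one)
qed

text \<open>After cancelling \<open>moore k x\<close>, equality says that the norm of
  \<open>t\<close> is zero; a product of powers of \<open>t\<close> vanishes in a field only for
  \<open>t = \<zero>\<close>.\<close>

lemma moore_shift_eq_iff:
  assumes x: "\<And>i. i < k \<Longrightarrow> x i \<in> carrier F" and t: "t \<in> carrier F"
    and z: "\<And>i. i < k \<Longrightarrow> z i = x i \<oplus> t \<otimes> (x i [^] q0)"
    and nz: "moore k x \<noteq> \<zero>"
  shows "moore k z = moore k x \<longleftrightarrow> t = \<zero>"
proof -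
  let ?N = "(- 1) ^ (k - 1) * (\<Prod>j<k. lift t ^ (q0 ^ j))"
  have "moore k z = moore k x \<longleftrightarrow> moore k x \<otimes> (\<one> \<oplus> h ?N) = moore k x \<otimes> \<one>"
    using moore_shift[OF x t z] moore_closed by simp
  also have "\<dots> \<longleftrightarrow> \<one> \<oplus> h ?N = \<one>"
    by (intro m_lcancel nz moore_closed) auto
  also have "\<dots> \<longleftrightarrow> h ?N = \<zero>"
    by (simp add: add.l_cancel_one)
  also have "\<dots> \<longleftrightarrow> t = \<zero>"
  proof
    assume "h ?N = \<zero>"
    moreover have "h ((- 1) ^ m) \<noteq> \<zero>" for m
      by (cases "even m") (use h_one h_uminus[of 1] in auto)
    ultimately have "h (\<Prod>j<k. lift t ^ (q0 ^ j)) = \<zero>"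
      by (simp add: h_mult_zero_iff)
    then obtain j where "h (lift t ^ (q0 ^ j)) = \<zero>"
      using h_prod_nonzero by metis
    then show "t = \<zero>"
      using t h_power_zeroD[of "lift t"] by simp
  next
    assume "t = \<zero>"
    then have "h (lift t ^ (q0 ^ j)) = h 0" for j
      using q0_ge by (simp add: h_power h_zero nat_pow_zero)
    then have "h (\<Prod>j<k. lift t ^ (q0 ^ j)) = h (\<Prod>j<k. 0)"
      by (intro h_prod_cong)
    then show "h ?N = \<zero>" using k by (simp add: h_mult h_zero power_0_left)
  qed
  finally show ?thesis .
qed

text \<open>Taking \<open>q0\<close>-th powers of the entries only permutes the columns cyclically,
  which costs the sign of a \<open>k\<close>-cycle.\<close>

lemma moore_frobenius:
  assumes x: "\<And>i. i < k \<Longrightarrow> x i \<in> carrier F"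
  shows "moore k x [^] q0 = moore k x \<otimes> h ((- 1) ^ (k - 1))"
proof -
  let ?X = "\<lambda>i j. lift (x i) ^ (q0 ^ j)"
  have "moore k x [^] q0 = h (det (mat k k (\<lambda>(i, j). ?X i j ^ q0)))"
    unfolding moore_def h_power[symmetric] by (rule h_frobenius_det)
  also have "\<dots> = h (det (mat k k (\<lambda>(i, j). 0 * ?X i j + 1 * ?X i (Suc j mod k))))"
  proof (rule h_det_cong)
    fix i j assume "i < k" "j < k"
    have "?X i j ^ q0 = lift (x i) ^ (q0 ^ Suc j)"
      by (simp add: power_mult[symmetric] mult.commute)
    then show "h (?X i j ^ q0) = h (0 * ?X i j + 1 * ?X i (Suc j mod k))"
      using h_power_cyclic[OF \<open>j < k\<close>] by simp
  qed
  also have "\<dots> = moore k x \<otimes> h ((- 1) ^ (k - 1))"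
    unfolding det_add_cyclic_shift[OF k, of 0 ?X "\<lambda>_. 1"] moore_def h_mult using k by (simp add: power_0_left)
  finally show ?thesis .
qed

section \<open>Counting values and nonzeros of the Moore determinant\<close>

text \<open>By \<open>moore_frobenius\<close> all values are roots of one polynomial
  \<open>Y ^ q0 - (- 1) ^ (k - 1) * Y\<close>.\<close>

lemma card_moore_values:
  assumes "\<And>x. x \<in> A \<Longrightarrow> x \<in> affine_points d F" and "k \<le> d"
  shows "card (moore k ` A) \<le> q0"
proof -
  let ?f = "Polynomial.monom 1 q0 - Polynomial.monom ((- 1) ^ (k - 1)) 1 :: 'r poly"
  have "degree ?f \<le> q0"
    by (intro degree_diff_le degree_monom_le le_trans[OF degree_monom_le]) (use q0_ge in auto)
  moreover have "h (Polynomial.coeff ?f q0) \<noteq> \<zero>"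
    using q0_ge by (simp add: h_one)
  ultimately have roots: "finite {y \<in> carrier F. h (poly ?f (lift y)) = \<zero>}"
    "card {y \<in> carrier F. h (poly ?f (lift y)) = \<zero>} \<le> q0"
    using card_roots_le by blast+
  have "moore k ` A \<subseteq> {y \<in> carrier F. h (poly ?f (lift y)) = \<zero>}"
  proof
    fix y assume "y \<in> moore k ` A"
    then obtain x where x: "x \<in> affine_points d F" "y = moore k x" using assms by auto
    then have "y [^] q0 = y \<otimes> h ((- 1) ^ (k - 1))"
      using moore_frobenius[of x] assms(2) by (auto simp: affine_points_def PiE_iff)
    then have "h (lift y ^ q0) = h ((- 1) ^ (k - 1) * lift y)"
      using moore_closed x by (simp add: h_power h_mult m_comm)
    then show "y \<in> {y \<in> carrier F. h (poly ?f (lift y)) = \<zero>}"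
      using moore_closed x by (simp add: h_cong_iff poly_monom)
  qed
  then show ?thesis
    using roots card_mono le_trans by blast
qed

text \<open>Expanded along the last row, the determinant is a polynomial in the new coordinate of
  degree at most \<open>q0 ^ n\<close>, whose coefficient there is the smaller Moore
  determinant.\<close>

lemma card_moore_extension_zero:
  assumes x: "\<And>i. i < n \<Longrightarrow> x i \<in> carrier F" and nz: "moore n x \<noteq> \<zero>"
  shows "card {y \<in> carrier F. moore (Suc n) (x(n := y)) = \<zero>} \<le> q0 ^ n"
proof -
  define A where "A y = mat (Suc n) (Suc n) (\<lambda>(i, j). lift ((x(n := y)) i) ^ (q0 ^ j))" for y
  define f where "f = (\<Sum>j<Suc n. Polynomial.monom (cofactor (A \<zero>) n j) (q0 ^ j))"
  \<comment> \<open>Only row \<open>n\<close> involves \<open>y\<close>, so its cofactors can be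
    taken at \<open>\<zero>\<close> and serve as fixed coefficients.\<close>
  have del: "mat_delete (A y) n j = mat_delete (A \<zero>) n j" for y j
    by (rule eq_matI) (auto simp: mat_delete_def A_def)
  have poly: "det (A y) = poly f (lift y)" for y
  proof -
    have "det (A y) = (\<Sum>j<Suc n. A y $$ (n, j) * cofactor (A y) n j)"
      by (rule laplace_expansion_row) (simp_all add: A_def)
    also have "\<dots> = poly f (lift y)"
      unfolding f_def poly_sum
    proof (intro sum.cong refl)
      fix j assume j: "j \<in> {..<Suc n}"
      have "A y $$ (n, j) = lift y ^ (q0 ^ j)" using j by (simp add: A_def)
      moreover have "cofactor (A y) n j = cofactor (A \<zero>) n j"
        unfolding cofactor_def del[of y] ..
      ultimately show "A y $$ (n, j) * cofactor (A y) n j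
          = poly (Polynomial.monom (cofactor (A \<zero>) n j) (q0 ^ j)) (lift y)"
        by (simp add: poly_monom mult.commute)
    qed
    finally show ?thesis .
  qed
  have "degree f \<le> q0 ^ n"
    unfolding f_def
    by (intro degree_sum_le) (auto intro!: le_trans[OF degree_monom_le] power_increasing
        simp: less_Suc_eq_le prime_gt_0_nat[OF prime] Suc_leI)
  moreover have "h (Polynomial.coeff f (q0 ^ n)) \<noteq> \<zero>"
  proof -
    \<comment> \<open>The exponents \<open>q0 ^ j\<close> are pairwise distinct because
      \<open>q0 \<ge> 2\<close>.\<close>
    have "Polynomial.coeff f (q0 ^ n) = (\<Sum>j<Suc n. if j = n then cofactor (A \<zero>) n j else 0)"
      unfolding f_def coeff_sum using q0_ge by (intro sum.cong) auto
    also have "\<dots> = det (mat_delete (A \<zero>) n n)"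
      by (simp add: cofactor_def)
    also have "mat_delete (A \<zero>) n n = mat n n (\<lambda>(i, j). lift (x i) ^ (q0 ^ j))"
      by (rule eq_matI) (auto simp: mat_delete_def A_def)
    finally show ?thesis using nz by (simp add: moore_def)
  qed
  ultimately have "card {y \<in> carrier F. h (poly f (lift y)) = \<zero>} \<le> q0 ^ n"
    using card_roots_le by blast
  then show ?thesis
    by (simp add: moore_def poly[unfolded A_def, symmetric])
qed

text \<open>Each coordinate loses at most half of its choices: for \<open>n < k\<close> at most
  \<open>q0 ^ n \<le> q0 ^ k / 2\<close> values are bad, and later coordinates do not affect the
  determinant. The \<open>min\<close> puts both ranges into one induction.\<close>

lemma card_moore_nonzero:
  "q0 ^ (k * n) \<le> 2 ^ n * card {x \<in> affine_points n F. moore (min n k) x \<noteq> \<zero>}"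
proof (induction n)
  case 0
  have "{x \<in> affine_points 0 F. moore (min 0 k) x \<noteq> \<zero>} = {\<lambda>_. undefined}"
    by (auto simp: affine_points_def moore_def h_one)
  then show ?case by simp
next
  case (Suc n)
  let ?G = "\<lambda>n. {x \<in> affine_points n F. moore (min n k) x \<noteq> \<zero>}"
  let ?E = "\<lambda>x. {y \<in> carrier F. moore (min (Suc n) k) (x(n := y)) \<noteq> \<zero>}"
  have finG: "finite (?G n)" for n
    using finite_affine_points by simp
  have E: "q0 ^ k \<le> 2 * card (?E x)" if x: "x \<in> ?G n" for x
  proof (cases "n < k")
    case True
    let ?Z = "{y \<in> carrier F. moore (Suc n) (x(n := y)) = \<zero>}"
    have "card ?Z \<le> q0 ^ n"
      using x True by (intro card_moore_extension_zero) (auto simp: affine_points_def PiE_iff)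
    moreover have "2 * q0 ^ n \<le> q0 ^ Suc n" using q0_ge by simp
    moreover have "q0 ^ Suc n \<le> q0 ^ k" using True q0_ge by (intro power_increasing) auto
    moreover have "?E x = carrier F - ?Z" using True by auto
    then have "card (?E x) = q0 ^ k - card ?Z"
      using finite_F card_F by (simp add: card_Diff_subset)
    ultimately show ?thesis by linarith
  next
    case False
    then have "moore k (x(n := y)) = moore k x" for y
      by (intro moore_cong) auto
    then have "?E x = carrier F" using x False by auto
    then show ?thesis by (simp add: card_F)
  qed
  have sub: "(\<lambda>(x, y). x(n := y)) ` Sigma (?G n) ?E \<subseteq> ?G (Suc n)"
  proof
    fix z assume "z \<in> (\<lambda>(x, y). x(n := y)) ` Sigma (?G n) ?E"
    then obtain x y where xy: "z = x(n := y)" "x \<in> affine_points n F" "y \<in> carrier F"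
      "moore (min (Suc n) k) (x(n := y)) \<noteq> \<zero>" by auto
    have "z \<in> affine_points (Suc n) F"
      unfolding xy(1) affine_points_def lessThan_Suc
      using xy(2,3) by (intro PiE_fun_upd) (simp_all add: affine_points_def)
    then show "z \<in> ?G (Suc n)" using xy(1,4) by simp
  qed
  have "inj_on (\<lambda>(x, y). x(n := y)) (Sigma (?G n) ?E)"
  proof (rule inj_onI, clarify)
    fix x y x' y'
    assume G: "x \<in> affine_points n F" "x' \<in> affine_points n F" and eq: "x(n := y) = x'(n := y')"
    have "x = x'"
    proof
      fix i show "x i = x' i"
        using fun_cong[OF eq, of i] G by (cases "i = n") (auto simp: affine_points_def PiE_iff extensional_def)
    qed
    then show "x = x' \<and> y = y'" using fun_cong[OF eq, of n] by simp
  qed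
  then have "card (Sigma (?G n) ?E) \<le> card (?G (Suc n))"
    using card_mono[OF finG sub] by (simp add: card_image)
  moreover have "card (Sigma (?G n) ?E) = (\<Sum>x\<in>?G n. card (?E x))"
    using finG finite_F by (intro card_SigmaI) auto
  ultimately have *: "(\<Sum>x\<in>?G n. card (?E x)) \<le> card (?G (Suc n))" by simp
  have "q0 ^ (k * Suc n) = q0 ^ (k * n) * q0 ^ k" by (simp add: power_add)
  also have "\<dots> \<le> 2 ^ n * card (?G n) * q0 ^ k"
    using Suc.IH by (rule mult_right_mono) simp
  also have "\<dots> = 2 ^ n * (\<Sum>x\<in>?G n. q0 ^ k)" by simp
  also have "\<dots> \<le> 2 ^ n * (\<Sum>x\<in>?G n. 2 * card (?E x))"
    by (intro mult_left_mono sum_mono E) auto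
  also have "\<dots> = 2 ^ Suc n * (\<Sum>x\<in>?G n. card (?E x))"
    by (simp add: sum_distrib_left[symmetric])
  also have "\<dots> \<le> 2 ^ Suc n * card (?G (Suc n))"
    using * by (rule mult_left_mono) simp
  finally show ?case .
qed

section \<open>From level sets to induced matchings\<close>

text \<open>Each point of the level set is paired with its own Frobenius line, which by
  \<open>moore_shift_eq_iff\<close> contains no other point of the set.\<close>

lemma card_moore_level_le_IM:
  assumes d: "k \<le> d" and c: "c \<noteq> \<zero>"
  shows "card {x \<in> affine_points d F. moore k x = c} \<le> IM d F"
proof -
  let ?S = "{x \<in> affine_points d F. moore k x = c}"
  define v where "v x = (\<lambda>i\<in>{..<d}. if i < k then x i [^] q0 else \<zero>)" for x :: "nat \<Rightarrow> 'a"
  define l where "l x = line_through d F x (v x)" for x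
  have finS: "finite ?S"
    using finite_affine_points by simp
  have coord: "x i \<in> carrier F" if "x \<in> ?S" "i < d" for x i
    using that by (auto simp: affine_points_def PiE_iff)
  have v: "v x \<in> affine_points d F" if "x \<in> ?S" for x
    using coord[OF that] by (auto simp: affine_points_def v_def)
  have shift: "moore k (\<lambda>i\<in>{..<d}. x i \<oplus> t \<otimes> v x i) = c \<longleftrightarrow> t = \<zero>"
    if "x \<in> ?S" "t \<in> carrier F" for x t
    using moore_shift_eq_iff[of x t "\<lambda>i\<in>{..<d}. x i \<oplus> t \<otimes> v x i"] that coord[OF that(1)] d c
    by (auto simp: v_def)
  have base: "(\<lambda>i\<in>{..<d}. x i \<oplus> \<zero> \<otimes> v x i) = x" if "x \<in> ?S" for x
  proof
    fix i show "(\<lambda>i\<in>{..<d}. x i \<oplus> \<zero> \<otimes> v x i) i = x i"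
      using coord[OF that, of i] v[OF that] that
      by (cases "i < d") (auto simp: affine_points_def PiE_iff extensional_def)
  qed
  have line: "l x \<in> affine_lines d F" if x: "x \<in> ?S" for x
  proof -
    \<comment> \<open>With a zero direction, the parameters \<open>\<one>\<close> and
      \<open>\<zero>\<close> would give the same point, although only \<open>\<zero>\<close> stays
      in the level set.\<close>
    have "\<exists>i<d. v x i \<noteq> \<zero>"
    proof (rule ccontr)
      assume "\<not> (\<exists>i<d. v x i \<noteq> \<zero>)"
      then have "(\<lambda>i\<in>{..<d}. x i \<oplus> \<one> \<otimes> v x i) = (\<lambda>i\<in>{..<d}. x i \<oplus> \<zero> \<otimes> v x i)"
        using coord[OF x] by (intro ext) auto
      then show False
        using shift[OF x one_closed] base[OF x] x by simp
    qed
    then show ?thesis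
      unfolding affine_lines_def l_def using x v[OF x] by blast
  qed
  have inc: "y \<in> l x \<longleftrightarrow> y = x" if "x \<in> ?S" "y \<in> ?S" for x y
  proof
    assume "y \<in> l x"
    then obtain t where t: "t \<in> carrier F" "y = (\<lambda>i\<in>{..<d}. x i \<oplus> t \<otimes> v x i)"
      unfolding l_def line_through_def by auto
    then have "t = \<zero>" using shift[OF that(1) t(1)] that(2) by simp
    then show "y = x" using t base[OF that(1)] by simp
  next
    assume "y = x"
    then have "y = (\<lambda>i\<in>{..<d}. x i \<oplus> \<zero> \<otimes> v x i)"
      using base[OF that(1)] by simp
    then show "y \<in> l x"
      unfolding l_def line_through_def using zero_closed by blast
  qed
  obtain p where p: "bij_betw p {0..<card ?S} ?S"
    using ex_bij_betw_nat_finite[OF finS] by blast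
  then have pS: "p i \<in> ?S" if "i < card ?S" for i
    using that unfolding bij_betw_def by auto
  have pinj: "p i = p j \<longleftrightarrow> i = j" if "i < card ?S" "j < card ?S" for i j
    using p that unfolding bij_betw_def inj_on_def by auto
  have "matching_pairs d F (card ?S) p (\<lambda>j. l (p j))"
    unfolding matching_pairs_def using pS line inc pinj by blast
  then show ?thesis
    by (rule IM_ge_pairs[OF finite_F])
qed

text \<open>The nonzero locus splits into at most \<open>q0\<close> level sets, each of size at most
  \<open>IM d F\<close>.\<close>

lemma IM_lower_bound:
  assumes d: "k \<le> d"
  shows "q0 ^ (k * d) \<le> 2 ^ d * (q0 * IM d F)"
proof -
  let ?G = "{x \<in> affine_points d F. moore k x \<noteq> \<zero>}"
  have finG: "finite ?G"
    using finite_affine_points by simp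
  have "card ?G = (\<Sum>c\<in>moore k ` ?G. card {x \<in> ?G. moore k x = c})"
    unfolding card_eq_sum using finG by (rule sum.image_gen)
  also have "\<dots> \<le> (\<Sum>c\<in>moore k ` ?G. IM d F)"
  proof (rule sum_mono)
    fix c assume "c \<in> moore k ` ?G"
    then have c: "c \<noteq> \<zero>" by auto
    then have "{x \<in> ?G. moore k x = c} = {x \<in> affine_points d F. moore k x = c}" by auto
    then show "card {x \<in> ?G. moore k x = c} \<le> IM d F"
      using card_moore_level_le_IM[OF d c] by simp
  qed
  also have "\<dots> = card (moore k ` ?G) * IM d F" by simp
  also have "\<dots> \<le> q0 * IM d F"
    by (rule mult_right_mono) (use card_moore_values[of ?G d] d in auto)
  finally have "card ?G \<le> q0 * IM d F" .
  moreover have "q0 ^ (k * d) \<le> 2 ^ d * card ?G"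
    using card_moore_nonzero[of d] d by (simp add: min_absorb2)
  ultimately show ?thesis
    by (meson le_trans mult_le_mono2)
qed

end

theorem theorem1p8:
  fixes d :: nat
  assumes "d \<ge> 2"
  shows "\<exists>c::real. c > 0 \<and>
    (\<forall>(k::nat) (q0::nat) (q::nat) (F :: nat ring).
       2 \<le> k \<and> k \<le> d \<and> Factorial_Ring.prime q0 \<and> q = q0 ^ k \<and>
       field F \<and> card (carrier F) = q
       \<longrightarrow> real (IM d F) \<ge> c * real q powr (real d - 1 / real k))"
\<comment> \<open>The constant is the fraction of points guaranteed to have nonzero Moore
  determinant.\<close>
proof (intro exI[of _ "1 / 2 ^ d"] conjI allI impI)
  fix k q0 q :: nat and F :: "nat ring"
  assume A: "2 \<le> k \<and> k \<le> d \<and> Factorial_Ring.prime q0 \<and> q = q0 ^ k \<and>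
       field F \<and> card (carrier F) = q"
  have q0: "q0 > 0" using A prime_gt_0_nat by blast
  then have "finite (carrier F)" using A by (intro card_ge_0_finite) simp
  then obtain h :: "int poly \<Rightarrow> nat" where "ring_cover F h"
    using exists_ring_cover A by blast
  then interpret prime_power_field F h q0 k
    using A by (simp add: prime_power_field_def prime_power_field_axioms_def)
  have "real q powr (real d - 1 / real k) = real q0 powr (real k * (real d - 1 / real k))"
    using A q0 by (simp add: powr_powr powr_realpow[symmetric])
  \<comment> \<open>In terms of \<open>q0\<close> the exponent is an integer; the lost factor
    \<open>q0\<close> is the bound on the number of level sets.\<close>
  also have "real k * (real d - 1 / real k) = real (k * d) - 1"
    using A by (simp add: field_simps)
  also have "real q0 powr \<dots> = real q0 ^ (k * d) / real q0"
    using q0 by (simp add: powr_diff powr_realpow del: of_nat_mult)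
  also have "\<dots> \<le> 2 ^ d * real (IM d F)"
  proof -
    have "real (q0 ^ (k * d)) \<le> real (2 ^ d * (q0 * IM d F))"
      using IM_lower_bound A of_nat_le_iff by blast
    then show ?thesis using q0 by (simp add: field_simps)
  qed
  finally show "real (IM d F) \<ge> 1 / 2 ^ d * real q powr (real d - 1 / real k)"
    by (simp add: field_simps)
qed simp

end
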